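(* Let $i\in\{1,2,3,4\}$, $j\in\{1,2,3\}$, let $\rho\in\mathbb{N}\setminus\{1\}$, $\vartheta\in\mathbb{Z}\setminus\{-1,0,1\}$, $\upsilon,\chi\in\mathbb{N}$ with $\chi\ge\upsilon$, and $\psi\in\mathbb{N}\cup\{0\}$. With $R_{1,n}^{(i,j)}$, $R_{2,n}^{(i,j)}$ and $r_n^{(i,j)}=q_n^{(i,j)}\zeta(3)-p_n^{(i,j)}$, $n=0,1,\dots$, as defined in the context, the following relation is valid: $$r_{n}^{(i,j)}=\frac{1}{2\pi \mathrm{i}}\int_{-1/2-\mathrm{i}\infty}^{-1/2+\mathrm{i}\infty}R_{1,n}^{(i,j)}(\nu)\left(\frac{\pi}{\sin\pi\nu}\right)^{2}d\nu=\sum_{t=0}^{\infty}R_{2,n}^{(i,j)}(t).$$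
   Context: $\mathbb{N}$ is the set of positive integers, $\mathrm{i}$ (upright) is the imaginary unit, $\zeta(s)=\sum_{m\ge1}m^{-s}$, $\delta_{a,b}$ is the Kronecker delta, $(\nu)_0=1$ and $(\nu)_n=\nu(\nu+1)\cdots(\nu+n-1)$ is the Pochhammer symbol, and $H_k^{(r)}=\sum_{l=1}^k l^{-r}$ is the harmonic number of order $r$. For $n=0,1,\dots$ define the rational functions of $t$ $$R_{1,n}(t)=\frac{(-t)_n^2}{(t+1)_{n+1}^2},\qquad R_{1,n}^{(i,j)}(t)=R_{1,n}(t)\,\theta^{(i,j)}(t),$$ $$\theta^{(i,j)}(t)=\frac{[\delta_{1,j}(t+n+\rho)+\delta_{2,j}(t+\vartheta n+1)+\delta_{3,j}(\upsilon t-\chi n-\psi)]^{\delta_{i,2}+1}}{(t-n+1)^{2-\delta_{i,1}}(t+n+1)^{-\delta_{i,3}}},$$ and $R_{2,n}^{(i,j)}(t)=\frac{d}{dt}R_{1,n}^{(i,j)}(t)$. The coefficients $a_{k,n}^{(i,j)}$ and $b_{k,n-\delta_{i,3}}^{(i,j)}$ are those of the partial fraction expansion $$R_{1,n}^{(i,j)}(t)=\sum_{k=0}^{n}\frac{a_{k,n}^{(i,j)}}{t+k+1}-\sum_{k=0}^{n-\delta_{i,3}}\frac{b_{k,n-\delta_{i,3}}^{(i,j)}}{(t+k+1)^2}.$$ Then $$q_{n}^{(i,j)}=2\sum_{k=0}^{n-\delta_{i,3}}b_{k,n-\delta_{i,3}}^{(i,j)},\qquad p_{n}^{(i,j)}=2\sum_{k=1}^{n-\delta_{i,3}}b_{k,n-\delta_{i,3}}^{(i,j)}H_{k}^{(3)}-\sum_{k=1}^{n}a_{k,n}^{(i,j)}H_{k}^{(2)},$$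 and $r_n^{(i,j)}=q_n^{(i,j)}\zeta(3)-p_n^{(i,j)}$.
   Formalization: The integral carries a minus sign: r_n = -(1/(2πi))∫ = ΣR_2(t), since the printed sign is false (n=0, i=1, j=2 gives -2ζ(3) against +2ζ(3)); for n=0 the claim on r_n is made only when the partial fraction expansion defining it exists. *)

theory Defs
  imports "HOL-Complex_Analysis.Complex_Analysis"
begin

definition kdelta :: "nat \<Rightarrow> nat \<Rightarrow> 'a :: zero_neq_one" where
  "kdelta a b = (if a = b then 1 else 0)"

(* The defining series of the Riemann zeta function; meaningful for Re s > 1 only. *)
definition zeta :: "complex \<Rightarrow> complex" where
  "zeta s = (\<Sum>m. of_nat (Suc m) powr (- s))"

definition gharm :: "nat \<Rightarrow> nat \<Rightarrow> complex" where
  "gharm r k = (\<Sum>l=1..k. 1 / of_nat l ^ r)"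

definition R_base :: "nat \<Rightarrow> complex \<Rightarrow> complex" where
  "R_base n t = (pochhammer (- t) n)\<^sup>2 / (pochhammer (t + 1) (n + 1))\<^sup>2"

definition theta_fun ::
  "nat \<Rightarrow> int \<Rightarrow> nat \<Rightarrow> nat \<Rightarrow> nat \<Rightarrow> nat \<Rightarrow> nat \<Rightarrow> nat \<Rightarrow> complex \<Rightarrow> complex" where
  "theta_fun \<rho> \<theta> \<upsilon> chi \<psi> i j n t =
     (kdelta 1 j * (t + of_nat n + of_nat \<rho>)
        + kdelta 2 j * (t + of_int \<theta> * of_nat n + 1)
        + kdelta 3 j * (of_nat \<upsilon> * t - of_nat chi * of_nat n - of_nat \<psi>)) ^ (kdelta i 2 + 1)
     / ((t - of_nat n + 1) powi (2 - kdelta i 1) * (t + of_nat n + 1) powi (- kdelta i 3))"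

(* The function below is a rational function of t in which common factors of numerator and
   denominator (for instance t - n + 1) cancel.  Because division by zero yields zero, the bare
   formula takes wrong values at such removable singularities; remove_sings restores the
   values of the rational function (and gives the value 0 at its poles). *)
definition R1 ::
  "nat \<Rightarrow> int \<Rightarrow> nat \<Rightarrow> nat \<Rightarrow> nat \<Rightarrow> nat \<Rightarrow> nat \<Rightarrow> nat \<Rightarrow> complex \<Rightarrow> complex" where
  "R1 \<rho> \<theta> \<upsilon> chi \<psi> i j n = remove_sings (\<lambda>t. R_base n t * theta_fun \<rho> \<theta> \<upsilon> chi \<psi> i j n t)"

definition R2 ::
  "nat \<Rightarrow> int \<Rightarrow> nat \<Rightarrow> nat \<Rightarrow> nat \<Rightarrow> nat \<Rightarrow> nat \<Rightarrow> nat \<Rightarrow> complex \<Rightarrow> complex" where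
  "R2 \<rho> \<theta> \<upsilon> chi \<psi> i j n = deriv (R1 \<rho> \<theta> \<upsilon> chi \<psi> i j n)"

(* The sums over k = 0, ..., n - kdelta i 3 are written with the strict bound
   k < n + 1 - kdelta i 3, so that they are empty for n = 0 and i = 3. *)
definition is_pf_expansion ::
  "nat \<Rightarrow> int \<Rightarrow> nat \<Rightarrow> nat \<Rightarrow> nat \<Rightarrow> nat \<Rightarrow> nat \<Rightarrow> nat
     \<Rightarrow> (nat \<Rightarrow> complex) \<Rightarrow> (nat \<Rightarrow> complex) \<Rightarrow> bool" where
  "is_pf_expansion \<rho> \<theta> \<upsilon> chi \<psi> i j n a b \<longleftrightarrow>
     (\<forall>t. (\<forall>k\<le>n. t \<noteq> - of_nat (k + 1)) \<longrightarrow>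
        R1 \<rho> \<theta> \<upsilon> chi \<psi> i j n t =
          (\<Sum>k\<le>n. a k / (t + of_nat k + 1))
            - (\<Sum>k<n + 1 - kdelta i 3. b k / (t + of_nat k + 1)\<^sup>2))"

(* The coefficients inside the summation ranges are uniquely determined by the expansion
   whenever it exists.  For n = 0 it may fail to exist: the denominator t - n + 1 of theta_fun
   is then t + 1, and R1 can have a pole of order greater than two at -1. *)
definition pf_coeffs ::
  "nat \<Rightarrow> int \<Rightarrow> nat \<Rightarrow> nat \<Rightarrow> nat \<Rightarrow> nat \<Rightarrow> nat \<Rightarrow> nat
     \<Rightarrow> (nat \<Rightarrow> complex) \<times> (nat \<Rightarrow> complex)" where
  "pf_coeffs \<rho> \<theta> \<upsilon> chi \<psi> i j n =
     (SOME ab. is_pf_expansion \<rho> \<theta> \<upsilon> chi \<psi> i j n (fst ab) (snd ab))"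

definition a_coeff ::
  "nat \<Rightarrow> int \<Rightarrow> nat \<Rightarrow> nat \<Rightarrow> nat \<Rightarrow> nat \<Rightarrow> nat \<Rightarrow> nat \<Rightarrow> nat \<Rightarrow> complex" where
  "a_coeff \<rho> \<theta> \<upsilon> chi \<psi> i j n = fst (pf_coeffs \<rho> \<theta> \<upsilon> chi \<psi> i j n)"

definition b_coeff ::
  "nat \<Rightarrow> int \<Rightarrow> nat \<Rightarrow> nat \<Rightarrow> nat \<Rightarrow> nat \<Rightarrow> nat \<Rightarrow> nat \<Rightarrow> nat \<Rightarrow> complex" where
  "b_coeff \<rho> \<theta> \<upsilon> chi \<psi> i j n = snd (pf_coeffs \<rho> \<theta> \<upsilon> chi \<psi> i j n)"

definition q_seq ::
  "nat \<Rightarrow> int \<Rightarrow> nat \<Rightarrow> nat \<Rightarrow> nat \<Rightarrow> nat \<Rightarrow> nat \<Rightarrow> nat \<Rightarrow> complex" where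
  "q_seq \<rho> \<theta> \<upsilon> chi \<psi> i j n =
     2 * (\<Sum>k<n + 1 - kdelta i 3. b_coeff \<rho> \<theta> \<upsilon> chi \<psi> i j n k)"

definition p_seq ::
  "nat \<Rightarrow> int \<Rightarrow> nat \<Rightarrow> nat \<Rightarrow> nat \<Rightarrow> nat \<Rightarrow> nat \<Rightarrow> nat \<Rightarrow> complex" where
  "p_seq \<rho> \<theta> \<upsilon> chi \<psi> i j n =
     2 * (\<Sum>k=1..<n + 1 - kdelta i 3. b_coeff \<rho> \<theta> \<upsilon> chi \<psi> i j n k * gharm 3 k)
       - (\<Sum>k=1..n. a_coeff \<rho> \<theta> \<upsilon> chi \<psi> i j n k * gharm 2 k)"

definition r_seq ::
  "nat \<Rightarrow> int \<Rightarrow> nat \<Rightarrow> nat \<Rightarrow> nat \<Rightarrow> nat \<Rightarrow> nat \<Rightarrow> nat \<Rightarrow> complex" where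
  "r_seq \<rho> \<theta> \<upsilon> chi \<psi> i j n =
     q_seq \<rho> \<theta> \<upsilon> chi \<psi> i j n * zeta 3 - p_seq \<rho> \<theta> \<upsilon> chi \<psi> i j n"

(* Integration along the line Re z = c, traversed upwards, with the parametrisation
   z = c + i y, dz = i dy. *)
definition vline_integrable :: "real \<Rightarrow> (complex \<Rightarrow> complex) \<Rightarrow> bool" where
  "vline_integrable c f \<longleftrightarrow> (\<lambda>y. f (Complex c y) * \<i>) integrable_on UNIV"

definition vline_integral :: "real \<Rightarrow> (complex \<Rightarrow> complex) \<Rightarrow> complex" where
  "vline_integral c f = integral UNIV (\<lambda>y. f (Complex c y) * \<i>)"

(* The half-plane Re z > c lies to the right of the upward line, so by the residue theorem
   the upward integral of R1(z) (pi / sin (pi z))^2 over Re z = -1/2 is -2 pi i times the sum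
   of the residues R2(t), t = 0, 1, 2, ...; a minus sign is therefore needed in any identity
   that equates this integral, divided by 2 pi i, with the sum of the R2(t). *)
definition sin_kernel_integrand ::
  "nat \<Rightarrow> int \<Rightarrow> nat \<Rightarrow> nat \<Rightarrow> nat \<Rightarrow> nat \<Rightarrow> nat \<Rightarrow> nat \<Rightarrow> complex \<Rightarrow> complex" where
  "sin_kernel_integrand \<rho> \<theta> \<upsilon> chi \<psi> i j n z =
     R1 \<rho> \<theta> \<upsilon> chi \<psi> i j n z * (of_real pi / sin (of_real pi * z))\<^sup>2"

end

theory Submission
  imports Defs "HOL-Probability.Sinc_Integral"
begin

text \<open>
  All the information about \<open>F = R1 \<dots> n\<close> that the analytic half
  needs is that \<open>F\<close> is a rational function with its poles among \<open>-1, \<dots>, -(n+1)\<close> whose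
  denominator degree exceeds the numerator degree by at least two (\<open>R1_rational\<close>); such a
  function is holomorphic on \<open>Re z > -1\<close> and satisfies \<open>\<bar>F z\<bar> \<le> C / \<bar>z + 1\<bar>\<^sup>2\<close> for
  \<open>Re z \<ge> -1/2\<close> (\<open>rational_function_right_half_plane\<close>).

  Put \<open>K z = (\<pi> / sin (\<pi> z))\<^sup>2\<close> and let \<open>I N\<close> be the integral of \<open>F K\<close> over the line
  \<open>Re z = N - 1/2\<close>.  The only singularity of \<open>F K\<close> between the lines for \<open>N\<close> and \<open>N + 1\<close> is
  \<open>N\<close>.  There \<open>K\<close> has principal part \<open>1 / (z - N)\<^sup>2\<close> because it is even about \<open>N\<close>, so the
  residue is \<open>F' N\<close> (\<open>residue_csc_kernel\<close>) and the residue theorem on tall rectangles gives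
  \<open>I (N + 1) - I N = 2 \<pi> \<i> F' N\<close> (\<open>vline_csc_kernel_shift\<close>).  On these lines
  \<open>\<bar>sin (\<pi> z)\<bar>\<^sup>2 = cosh\<^sup>2 (\<pi> Im z)\<close>, hence \<open>K\<close> is bounded there by an integrable function
  that is the same for all \<open>N\<close>, and the decay of \<open>F\<close> forces \<open>I N \<longlonglongrightarrow> 0\<close>
  (\<open>vline_csc_kernel_tendsto_0\<close>).  Telescoping yields at once that \<open>\<Sum>t. F' t\<close> converges and
  that it equals \<open>- I 0 / (2 \<pi> \<i>)\<close> (\<open>vline_csc_kernel_sums\<close>).  Crossing one pole at a time
  in this way needs no contour around many poles: the horizontal edges always have length one.

  The identification with \<open>q \<zeta>(3) - p\<close> differentiates the partial fraction expansion
  termwise (\<open>partial_fraction_deriv_sums\<close>).  A term \<open>a k / (t + k + 1)\<close> contributes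
  \<open>- a k (\<zeta>(2) - H\<^sub>k\<^sup>(\<^sup>2\<^sup>))\<close> and \<open>- b k / (t + k + 1)\<^sup>2\<close> contributes
  \<open>2 b k (\<zeta>(3) - H\<^sub>k\<^sup>(\<^sup>3\<^sup>))\<close>; the multiples of \<open>\<zeta>(2)\<close> cancel since quadratic decay means
  that the coefficients \<open>a k\<close> add up to zero.  For \<open>n \<ge> 1\<close> the expansion exists because the
  zeros of \<open>(-t)\<^sub>n\<^sup>2\<close> absorb the factor \<open>t - n + 1\<close> of the denominator, which leaves only
  poles of order at most two (\<open>is_pf_expansion_exists\<close>).
\<close>

section \<open>The squared cosecant kernel\<close>

definition csc_kernel :: "complex \<Rightarrow> complex" where
  "csc_kernel z = (of_real pi / sin (of_real pi * z))\<^sup>2"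

lemma inverse_one_plus_square_integrable:
  "(\<lambda>y::real. 1 / (1 + y\<^sup>2)) integrable_on UNIV"
proof -
  have "einterval (- \<infinity>) \<infinity> = UNIV"
    by (auto simp: einterval_def)
  hence "integrable lborel (\<lambda>y::real. inverse (1 + y\<^sup>2))"
    using integrable_inverse_1_plus_square by (simp add: set_integrable_def)
  from has_integral_integral_lborel[OF this] show ?thesis
    by (auto simp: integrable_on_def inverse_eq_divide)
qed

text \<open>
  This is \<open>\<bar>sin z\<bar>\<^sup>2 = sin\<^sup>2 (Re z) + sinh\<^sup>2 (Im z)\<close> with \<open>\<bar>sinh y\<bar> \<ge> \<bar>y\<bar>\<close>.  Keeping the term
  \<open>sin\<^sup>2 (Re z)\<close>, written with the double angle, allows one bound to serve both kinds of edges
  once \<open>z\<close> is replaced by \<open>\<pi> z\<close>: on vertical lines through half-integers that term is 1, and on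
  the horizontal edges of the rectangles it is used only as a nonnegative quantity.
\<close>
lemma norm_sin_squared_ge:
  fixes z :: complex
  shows "(Im z)\<^sup>2 + (1 - cos (2 * Re z)) / 2 \<le> (norm (sin z))\<^sup>2"
proof -
  have "\<bar>Im z\<bar> \<le> \<bar>sinh (Im z)\<bar>"
    unfolding sinh_field_def using real_le_abs_sinh[of "Im z"] by (simp add: exp_minus)
  hence "(Im z)\<^sup>2 \<le> (sinh (Im z))\<^sup>2"
    by (simp add: abs_le_square_iff)
  also have "(sinh (Im z))\<^sup>2 = (exp (2 * Im z) + inverse (exp (2 * Im z)) - 2) / 4"
  proof -
    define a where "a = exp (Im z)"
    have e: "exp (2 * Im z) = a\<^sup>2" and a: "a > 0" by (simp_all add: a_def exp_double)
    have "sinh (Im z) = (a - 1 / a) / 2"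
      by (simp add: sinh_field_def a_def exp_minus inverse_eq_divide)
    hence "(sinh (Im z))\<^sup>2 = ((a - 1 / a) / 2)\<^sup>2" by (simp only:)
    also have "\<dots> = (a\<^sup>2 + inverse (a\<^sup>2) - 2) / 4"
      using a by (simp add: power2_eq_square field_simps)
    finally show ?thesis by (simp only: e)
  qed
  finally show ?thesis
    by (simp add: norm_sin_squared field_simps)
qed

lemma norm_csc_kernel_le:
  assumes "0 < (Im z)\<^sup>2 * pi\<^sup>2 + (1 - cos (2 * pi * Re z)) / 2"
  shows "norm (csc_kernel z) \<le> pi\<^sup>2 / ((Im z)\<^sup>2 * pi\<^sup>2 + (1 - cos (2 * pi * Re z)) / 2)"
proof -
  have "(Im z)\<^sup>2 * pi\<^sup>2 + (1 - cos (2 * pi * Re z)) / 2 \<le> (norm (sin (of_real pi * z)))\<^sup>2"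
    using norm_sin_squared_ge[of "of_real pi * z"] by (simp add: power_mult_distrib mult_ac)
  thus ?thesis
    using assms unfolding csc_kernel_def norm_divide norm_power power_divide
    by (simp, intro divide_left_mono mult_pos_pos) auto
qed

lemma sin_pi_times_eq_0_iff:
  fixes z :: complex
  shows "sin (of_real pi * z) = 0 \<longleftrightarrow> z \<in> \<int>"
proof -
  have "sin (of_real pi * z) = 0 \<longleftrightarrow> (\<exists>n::int. of_real pi * z = of_real (of_int n * pi))"
    unfolding sin_eq_0 by simp
  also have "\<dots> \<longleftrightarrow> (\<exists>n::int. z = of_int n)"
    by (intro ex_cong1) (auto simp: complex_eq_iff)
  finally show ?thesis by (auto simp: Ints_def)
qed

text \<open>
  After multiplication by \<open>(z - m)\<^sup>2\<close> the kernel becomes a holomorphic function that is even about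
  \<open>m\<close> with value 1, so its first-order Taylor coefficient vanishes and the residue sees only
  the first derivative of \<open>F\<close>.
\<close>
lemma residue_csc_kernel:
  fixes m :: int
  assumes F: "F holomorphic_on A" and A: "open A" "of_int m \<in> A"
  shows "residue (\<lambda>z. F z * csc_kernel z) (of_int m) = deriv F (of_int m)"
proof -
  define S :: "complex \<Rightarrow> complex"
    where "S w = (if w = 0 then of_real pi else sin (of_real pi * w) / w)" for w
  define B :: "complex set" where "B = A \<inter> ball (of_int m) 1"
  define H where "H z = F z * (of_real pi / S (z - of_int m))\<^sup>2" for z
  \<comment> \<open>\<open>S\<close> is a difference quotient of \<open>sin\<close> with its removable singularity filled in.\<close>
  have "deriv (\<lambda>w. sin (of_real pi * w :: complex)) 0 = of_real pi"
    by (rule DERIV_imp_deriv) (auto intro!: derivative_eq_intros)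
  hence S_eq: "S = (\<lambda>z. if z = 0 then deriv (\<lambda>w. sin (of_real pi * w)) 0
                 else (sin (of_real pi * z) - sin (of_real pi * 0)) / (z - 0))"
    by (auto simp: S_def)
  have S_holo: "S holomorphic_on UNIV"
    unfolding S_eq by (rule pole_lemma) (auto intro!: holomorphic_intros)
  obtain S' where S': "(S has_field_derivative S') (at 0)"
    using S_holo by (metis UNIV_I holomorphic_derivI open_UNIV)
  \<comment> \<open>\<open>S\<close> is even, so its derivative at the origin vanishes.\<close>
  have neg: "((\<lambda>w. - w) has_field_derivative -1) (at (0::complex))"
    by (auto intro!: derivative_eq_intros)
  have "((\<lambda>w. S (- w)) has_field_derivative - S') (at 0)"
    using DERIV_chain2[where f = S and g = "\<lambda>w. - w" and x = 0, OF _ neg, of S'] S'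
    by (metis add.inverse_neutral mult_minus1_right)
  moreover have "(\<lambda>w. S (- w)) = S" by (auto simp: S_def)
  ultimately have "(S has_field_derivative - S') (at 0)" by (simp only:)
  from DERIV_unique[OF S' this] have "S' = 0" by simp
  have S_nz: "S w \<noteq> 0" if "norm w < 1" for w
  proof (cases "w = 0")
    case False
    have "w \<notin> \<int>"
    proof
      assume "w \<in> \<int>"
      then obtain k :: int where k: "w = of_int k" by (auto elim: Ints_cases)
      hence "\<bar>of_int k :: real\<bar> < 1" using that by (simp add: norm_of_int)
      with False k show False by simp
    qed
    thus ?thesis using False by (simp add: S_def sin_pi_times_eq_0_iff)
  qed (simp add: S_def)
  have B: "open B" "of_int m \<in> B" using A by (auto simp: B_def)
  have SB: "S (z - of_int m) \<noteq> 0" if "z \<in> B" for z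
    using that by (intro S_nz) (simp add: B_def dist_norm norm_minus_commute)
  have "(\<lambda>z. S (z - of_int m)) holomorphic_on B"
    by (rule holomorphic_on_compose_gen[OF _ S_holo, of "\<lambda>z. z - of_int m", unfolded o_def])
       (auto intro!: holomorphic_intros)
  hence H_holo: "H holomorphic_on B"
    unfolding H_def using SB F
    by (auto intro!: holomorphic_intros simp: B_def elim: holomorphic_on_subset)
  have "eventually (\<lambda>z. z \<in> B - {of_int m}) (at (of_int m))"
    using B by (intro eventually_at_in_open) auto
  hence "eventually (\<lambda>z. F z * csc_kernel z = H z / (z - of_int m) ^ Suc 1) (at (of_int m))"
  proof eventually_elim
    case (elim z)
    define w where "w = z - of_int m"
    have z: "z = w + of_int m" and "w \<noteq> 0" using elim by (auto simp: w_def)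
    have "(sin (of_real pi * z))\<^sup>2 = (sin (of_real pi * w))\<^sup>2"
    proof -
      have "sin (of_real pi * z) = sin (of_real pi * w) * cos (of_real pi * of_int m)
          + cos (of_real pi * w) * sin (of_real pi * of_int m)"
        by (simp add: z sin_add ring_distribs)
      moreover have "sin (of_real pi * of_int m :: complex) = 0"
        by (simp add: sin_pi_times_eq_0_iff)
      moreover from this have "(cos (of_real pi * of_int m :: complex))\<^sup>2 = 1"
        using sin_cos_squared_add[of "of_real pi * of_int m :: complex"] by simp
      ultimately show ?thesis by (simp add: power_mult_distrib)
    qed
    thus ?case using \<open>w \<noteq> 0\<close>
      by (simp add: csc_kernel_def H_def S_def power_divide power2_eq_square flip: w_def)
  qed
  hence "residue (\<lambda>z. F z * csc_kernel z) (of_int m)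
       = residue (\<lambda>z. H z / (z - of_int m) ^ Suc 1) (of_int m)"
    by (intro residue_cong) auto
  also have "\<dots> = deriv H (of_int m)"
    using residue_holomorphic_over_power[OF B H_holo, of 1] by simp
  also have "deriv H (of_int m) = deriv F (of_int m)"
  proof (rule DERIV_imp_deriv)
    have F': "(F has_field_derivative deriv F (of_int m)) (at (of_int m))"
      using F A by (rule holomorphic_derivI)
    have S0: "((\<lambda>z. S (z - of_int m)) has_field_derivative 0) (at (of_int m))"
    proof -
      have "((\<lambda>z. z - of_int m) has_field_derivative 1) (at (of_int m :: complex))"
        by (auto intro!: derivative_eq_intros)
      from DERIV_chain2[OF _ this, of S 0] S' \<open>S' = 0\<close> show ?thesis by simp
    qed
    show "(H has_field_derivative deriv F (of_int m)) (at (of_int m))"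
      unfolding H_def
      by (rule derivative_eq_intros F' S0 refl | simp add: S_def)+
  qed
  finally show ?thesis .
qed

section \<open>Moving the vertical line of integration\<close>

lemma integral_symmetric_interval_tendsto:
  fixes f :: "real \<Rightarrow> 'a::banach"
  assumes "f integrable_on UNIV"
  shows "((\<lambda>T. integral {-T..T} f) \<longlongrightarrow> integral UNIV f) at_top"
proof (rule tendstoI)
  fix e :: real assume "e > 0"
  with integrable_integral[OF assms] obtain B where
    B: "\<And>a b. ball 0 B \<subseteq> cbox a b \<Longrightarrow>
          norm (integral (cbox a b) f - integral UNIV f) < e"
    unfolding has_integral_alt'[of f] by force
  show "eventually (\<lambda>T. dist (integral {-T..T} f) (integral UNIV f) < e) at_top"
    using eventually_ge_at_top[of B]
  proof eventually_elim
    case (elim T)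
    have "ball 0 B \<subseteq> cbox (-T) T" using elim by (auto simp: dist_norm)
    from B[OF this] show ?case by (simp add: dist_norm)
  qed
qed

lemma csc_kernel_holomorphic:
  "csc_kernel holomorphic_on (- \<int>)"
  unfolding csc_kernel_def by (intro holomorphic_intros) (auto simp: sin_pi_times_eq_0_iff)

lemma decay_constant_nonneg:
  fixes F :: "complex \<Rightarrow> complex"
  assumes bound: "\<And>z. Re z \<ge> -1/2 \<Longrightarrow> norm (F z) \<le> C / norm (z + 1) ^ 2"
  shows "C \<ge> 0"
proof -
  have "norm (F 0) \<le> C" using bound[of 0] by simp
  thus ?thesis using norm_ge_zero order_trans by blast
qed

text \<open>
  The factor depending on \<open>N\<close> comes from the decay of \<open>F\<close> and the one depending on \<open>y\<close> from
  the kernel.  This separation gives integrability for each \<open>N\<close> and the limit for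
  \<open>N \<longlonglongrightarrow> \<infinity>\<close> from the same estimate.
\<close>
lemma vline_csc_kernel_bound:
  fixes N :: nat
  assumes bound: "\<And>z. Re z \<ge> -1/2 \<Longrightarrow> norm (F z) \<le> C / norm (z + 1) ^ 2"
  shows "norm (F (Complex (real N - 1/2) y) * csc_kernel (Complex (real N - 1/2) y) * \<i>)
           \<le> C * pi\<^sup>2 / (real N + 1/2)\<^sup>2 * (1 / (1 + y\<^sup>2))"
proof -
  let ?z = "Complex (real N - 1/2) y"
  have C: "C \<ge> 0" by (rule decay_constant_nonneg[OF bound])
  have "cos (2 * pi * (real N - 1/2)) = cos (2 * pi * real N - pi)"
    by (simp add: algebra_simps)
  also have "\<dots> = -1" using cos_2npi[of N] by (simp add: cos_diff mult_ac)
  finally have c: "cos (2 * pi * Re ?z) = -1" by simp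
  have "y\<^sup>2 * 1 \<le> y\<^sup>2 * pi\<^sup>2"
    using pi_gt3 by (intro mult_left_mono one_le_power) auto
  hence y: "1 + y\<^sup>2 \<le> y\<^sup>2 * pi\<^sup>2 + 1" by simp
  have "norm (csc_kernel ?z) \<le> pi\<^sup>2 / (y\<^sup>2 * pi\<^sup>2 + 1)"
    using norm_csc_kernel_le[of ?z] unfolding c by (simp add: add_nonneg_pos)
  also have "\<dots> \<le> pi\<^sup>2 / (1 + y\<^sup>2)"
    using y by (intro divide_left_mono mult_pos_pos) (simp_all add: add_pos_nonneg add_nonneg_pos)
  finally have K: "norm (csc_kernel ?z) \<le> pi\<^sup>2 / (1 + y\<^sup>2)" .
  have "real N + 1/2 \<le> norm (?z + 1)"
    using complex_Re_le_cmod[of "?z + 1"] by simp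
  hence "C / norm (?z + 1) ^ 2 \<le> C / (real N + 1/2)\<^sup>2"
    using C by (intro divide_left_mono power_mono) (auto intro!: mult_pos_pos)
  with bound[of ?z] have "norm (F ?z) \<le> C / (real N + 1/2)\<^sup>2" by simp
  from mult_mono[OF this K] have "norm (F ?z) * norm (csc_kernel ?z)
      \<le> C / (real N + 1/2)\<^sup>2 * (pi\<^sup>2 / (1 + y\<^sup>2))"
    using C by simp
  thus ?thesis by (simp add: norm_mult mult_ac)
qed

lemma half_integer_line_not_Ints:
  "Complex (real N - 1/2) y \<notin> \<int>"
proof
  assume "Complex (real N - 1/2) y \<in> \<int>"
  then obtain k :: int where "Complex (real N - 1/2) y = of_int k" by (auto elim: Ints_cases)
  hence "real N - 1/2 = of_int k" by (simp add: complex_eq_iff)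
  hence "of_int (2 * int N - 1) = (of_int (2 * k) :: real)" by simp
  hence "2 * int N - 1 = 2 * k" by (simp only: of_int_eq_iff)
  thus False by presburger
qed

lemma vline_csc_kernel_integrable:
  fixes N :: nat
  assumes F: "F holomorphic_on {z. Re z > -1}"
    and bound: "\<And>z. Re z \<ge> -1/2 \<Longrightarrow> norm (F z) \<le> C / norm (z + 1) ^ 2"
  shows "vline_integrable (real N - 1/2) (\<lambda>z. F z * csc_kernel z)"
  unfolding vline_integrable_def
proof (rule integrable_on_all_intervals_UNIV)
  have "continuous_on ({z. Re z > -1} \<inter> - \<int>) (\<lambda>z. F z * csc_kernel z)"
    using F csc_kernel_holomorphic
    by (intro holomorphic_on_imp_continuous_on holomorphic_intros)
       (auto elim: holomorphic_on_subset)
  moreover have "continuous_on UNIV (\<lambda>y. Complex (real N - 1/2) y)"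
    by (auto simp: Complex_eq intro!: continuous_intros)
  ultimately have "continuous_on UNIV
      (\<lambda>y. F (Complex (real N - 1/2) y) * csc_kernel (Complex (real N - 1/2) y))"
    by (rule continuous_on_compose2) (auto simp: half_integer_line_not_Ints)
  hence "continuous_on UNIV
      (\<lambda>y. F (Complex (real N - 1/2) y) * csc_kernel (Complex (real N - 1/2) y) * \<i>)"
    by (rule continuous_on_mult_right)
  thus "(\<lambda>y. F (Complex (real N - 1/2) y) * csc_kernel (Complex (real N - 1/2) y) * \<i>)
          integrable_on cbox a b" for a b
    by (intro integrable_continuous) (auto elim: continuous_on_subset)
  show "norm (F (Complex (real N - 1/2) y) * csc_kernel (Complex (real N - 1/2) y) * \<i>)
           \<le> C * pi\<^sup>2 / (real N + 1/2)\<^sup>2 * (1 / (1 + y\<^sup>2))" for y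
    by (rule vline_csc_kernel_bound[OF bound])
  show "(\<lambda>y. C * pi\<^sup>2 / (real N + 1/2)\<^sup>2 * (1 / (1 + y\<^sup>2))) integrable_on UNIV"
    by (intro integrable_on_mult_right inverse_one_plus_square_integrable)
qed

lemma vline_csc_kernel_tendsto_0:
  assumes F: "F holomorphic_on {z. Re z > -1}"
    and bound: "\<And>z. Re z \<ge> -1/2 \<Longrightarrow> norm (F z) \<le> C / norm (z + 1) ^ 2"
  shows "(\<lambda>N. vline_integral (real N - 1/2) (\<lambda>z. F z * csc_kernel z)) \<longlonglongrightarrow> 0"
proof (rule Lim_null_comparison)
  define J where "J = integral UNIV (\<lambda>y::real. 1 / (1 + y\<^sup>2))"
  show "eventually (\<lambda>N. norm (vline_integral (real N - 1/2) (\<lambda>z. F z * csc_kernel z))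
          \<le> C * pi\<^sup>2 / (real N + 1/2)\<^sup>2 * J) sequentially"
  proof (rule always_eventually, rule allI)
    fix N
    have "norm (vline_integral (real N - 1/2) (\<lambda>z. F z * csc_kernel z))
        \<le> integral UNIV (\<lambda>y::real. C * pi\<^sup>2 / (real N + 1/2)\<^sup>2 * (1 / (1 + y\<^sup>2)))"
      unfolding vline_integral_def
      using vline_csc_kernel_integrable[OF assms] vline_csc_kernel_bound[OF bound]
      by (intro integral_norm_bound_integral integrable_on_mult_right
            inverse_one_plus_square_integrable) (auto simp: vline_integrable_def)
    thus "norm (vline_integral (real N - 1/2) (\<lambda>z. F z * csc_kernel z))
          \<le> C * pi\<^sup>2 / (real N + 1/2)\<^sup>2 * J"
      by (simp only: J_def integral_mult_right)
  qed
  show "(\<lambda>N. C * pi\<^sup>2 / (real N + 1/2)\<^sup>2 * J) \<longlonglongrightarrow> 0"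
    by real_asymp
qed

text \<open>
  The rectangle between the two lines with height \<open>2 T\<close> contains the single pole \<open>N\<close>.  Its
  horizontal edges have length one and carry the kernel bound \<open>1 / T\<^sup>2\<close>, so only the
  vertical edges survive when \<open>T\<close> tends to infinity.
\<close>
lemma vline_csc_kernel_shift:
  fixes N :: nat
  assumes F: "F holomorphic_on {z. Re z > -1}"
    and bound: "\<And>z. Re z \<ge> -1/2 \<Longrightarrow> norm (F z) \<le> C / norm (z + 1) ^ 2"
  shows "vline_integral (real (Suc N) - 1/2) (\<lambda>z. F z * csc_kernel z)
       - vline_integral (real N - 1/2) (\<lambda>z. F z * csc_kernel z)
       = 2 * of_real pi * \<i> * deriv F (of_nat N)"
proof -
  define G where "G = (\<lambda>z. F z * csc_kernel z)"
  define V where "V c T = integral {-T..T} (\<lambda>y. G (Complex c y) * \<i>)" for c T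
  define l r where "l = real N - 1/2" and "r = real (Suc N) - 1/2"
  \<comment> \<open>The defect of the claim at height \<open>T\<close>, which equals the contribution of the horizontal edges.\<close>
  define E where "E T = V r T - V l T - 2 * of_real pi * \<i> * deriv F (of_nat N)" for T
  define S where "S = {z. real N - 1 < Re z} \<inter> {z. Re z < real N + 1}"
  have S: "open S" "convex S"
    unfolding S_def by (auto intro!: open_Int open_halfspace_Re_gt open_halfspace_Re_lt
        convex_Int convex_halfspace_Re_gt convex_halfspace_Re_lt)
  have S_Ints: "z \<notin> \<int>" if "z \<in> S - {of_nat N}" for z
  proof
    assume "z \<in> \<int>"
    then obtain k :: int where k: "z = of_int k" by (auto elim: Ints_cases)
    have "real_of_int (int N - 1) < of_int k" "real_of_int k < of_int (int N + 1)"
      using that k by (auto simp: S_def)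
    hence "k = int N" by (simp only: of_int_less_iff)
    with that k show False by auto
  qed
  have G_holo: "G holomorphic_on S - {of_nat N}"
    unfolding G_def using F csc_kernel_holomorphic S_Ints
    by (intro holomorphic_intros) (auto elim!: holomorphic_on_subset simp: S_def)
  have res: "residue G (of_nat N) = deriv F (of_nat N)"
    using residue_csc_kernel[OF F, of "int N"] by (simp add: G_def open_halfspace_Re_gt)
  have edge: "norm (contour_integral (linepath (Complex l t) (Complex r t)) G) \<le> C * 4 / t\<^sup>2
     \<and> G contour_integrable_on linepath (Complex l t) (Complex r t)" if "t \<noteq> 0" for t
  proof -
    have seg: "closed_segment (Complex l t) (Complex r t) = {z. Im z = t \<and> l \<le> Re z \<and> Re z \<le> r}"
      by (subst closed_segment_same_Im) (auto simp: l_def r_def closed_segment_eq_real_ivl)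
    have "closed_segment (Complex l t) (Complex r t) \<subseteq> S - {of_nat N}"
      unfolding seg using that by (auto simp: S_def l_def r_def)
    hence int: "G contour_integrable_on linepath (Complex l t) (Complex r t)"
      using G_holo by (intro contour_integrable_holomorphic_simple[of _ "S - {of_nat N}"])
        (auto simp: S open_delete)
    have C: "C \<ge> 0" by (rule decay_constant_nonneg[OF bound])
    have "norm (G z) \<le> C * 4 / t\<^sup>2" if z: "z \<in> closed_segment (Complex l t) (Complex r t)" for z
    proof -
      have z': "Im z = t" "Re z \<ge> -1/2" using z unfolding seg by (auto simp: l_def)
      \<comment> \<open>On the edges crude boundedness of \<open>F\<close> is enough; the factor 4 is \<open>1 / (1/2)\<^sup>2\<close>.\<close>
      have "1/2 \<le> norm (z + 1)" using complex_Re_le_cmod[of "z + 1"] z' by simp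
      hence "(1/2)\<^sup>2 \<le> norm (z + 1) ^ 2" by (intro power_mono) auto
      hence "C / norm (z + 1) ^ 2 \<le> C / (1/2)\<^sup>2"
        using C by (intro divide_left_mono) (auto intro!: mult_pos_pos simp: power2_eq_square)
      with bound[OF z'(2)] have F1: "norm (F z) \<le> C * 4" by (simp add: power2_eq_square)
      have t: "0 < t\<^sup>2 * pi\<^sup>2" using \<open>t \<noteq> 0\<close> by simp
      have "t\<^sup>2 * pi\<^sup>2 \<le> t\<^sup>2 * pi\<^sup>2 + (1 - cos (2 * pi * Re z)) / 2" by simp
      with t norm_csc_kernel_le[of z] have "norm (csc_kernel z)
          \<le> pi\<^sup>2 / (t\<^sup>2 * pi\<^sup>2 + (1 - cos (2 * pi * Re z)) / 2)"
        unfolding z' by linarith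
      also have "\<dots> \<le> pi\<^sup>2 / (t\<^sup>2 * pi\<^sup>2)"
        using t by (intro divide_left_mono mult_pos_pos) (auto intro: add_pos_nonneg)
      finally have K1: "norm (csc_kernel z) \<le> 1 / t\<^sup>2" by simp
      from mult_mono[OF F1 K1] C show ?thesis by (simp add: G_def norm_mult)
    qed
    moreover have "0 \<le> C * 4 / t\<^sup>2" using C by simp
    ultimately have "norm (contour_integral (linepath (Complex l t) (Complex r t)) G)
        \<le> C * 4 / t\<^sup>2 * norm (Complex r t - Complex l t)"
      using int by (intro contour_integral_bound_linepath) auto
    also have "Complex r t - Complex l t = 1" by (simp add: complex_eq_iff l_def r_def)
    finally show ?thesis using int by simp
  qed
  have side: "contour_integral (linepath (Complex c (-T)) (Complex c T)) G = V c T
     \<and> G contour_integrable_on linepath (Complex c (-T)) (Complex c T)"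
    if "T > 0" "c \<in> {l, r}" for c T
  proof -
    have "closed_segment (Complex c (-T)) (Complex c T) \<subseteq> S - {of_nat N}"
      using that by (subst closed_segment_same_Re) (auto simp: S_def l_def r_def)
    hence "G contour_integrable_on linepath (Complex c (-T)) (Complex c T)"
      using G_holo by (intro contour_integrable_holomorphic_simple[of _ "S - {of_nat N}"])
        (auto simp: S open_delete)
    thus ?thesis using \<open>T > 0\<close>
      by (simp add: contour_integral_linepath_same_Re[of _ c _ "-T" T] V_def mult.commute)
  qed
  have E_bound: "norm (E T) \<le> C * 8 / T\<^sup>2" if "T > 0" for T
  proof -
    let ?p = "rectpath (Complex l (-T)) (Complex r T)"
    have img: "path_image ?p \<subseteq> S - {of_nat N}"
      using that by (subst path_image_rectpath) (auto simp: S_def l_def r_def)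
    have out: "winding_number ?p z = 0" if "z \<notin> S" for z
      using \<open>T > 0\<close> that
      by (intro winding_number_rectpath_outside) (auto simp: in_cbox_complex_iff S_def l_def r_def)
    have inn: "winding_number ?p (of_nat N) = 1"
      using \<open>T > 0\<close> by (intro winding_number_rectpath) (auto simp: in_box_complex_iff l_def r_def)
    have "contour_integral ?p G = 2 * pi * \<i> *
        (\<Sum>p\<in>{of_nat N}. winding_number ?p p * residue G p)"
      using S G_holo img out
      by (intro Residue_theorem[of S]) (auto simp: convex_connected)
    hence "contour_integral ?p G = 2 * of_real pi * \<i> * deriv F (of_nat N)"
      by (simp add: inn res)
    moreover have "contour_integral ?p G =
        contour_integral (linepath (Complex l (-T)) (Complex r (-T))) G + V r T
        - contour_integral (linepath (Complex l T) (Complex r T)) G - V l T"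
    proof -
      note i1 = edge[of T, THEN conjunct2] edge[of "-T", THEN conjunct2]
        side[of T l, THEN conjunct2] side[of T r, THEN conjunct2]
      have i2: "G contour_integrable_on linepath (Complex r T) (Complex l T)"
        "G contour_integrable_on linepath (Complex l T) (Complex l (-T))"
        using i1 \<open>T > 0\<close> contour_integrable_reversepath[of "linepath (Complex l T) (Complex r T)" G]
          contour_integrable_reversepath[of "linepath (Complex l (-T)) (Complex l T)" G]
        by auto
      have r1: "contour_integral (linepath (Complex r T) (Complex l T)) G =
          - contour_integral (linepath (Complex l T) (Complex r T)) G"
        "contour_integral (linepath (Complex l T) (Complex l (-T))) G =
          - contour_integral (linepath (Complex l (-T)) (Complex l T)) G"
        using contour_integral_reversepath[of "linepath (Complex l T) (Complex r T)" G]
          contour_integral_reversepath[of "linepath (Complex l (-T)) (Complex l T)" G]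
        by auto
      show ?thesis
        using i1 i2 \<open>T > 0\<close> side[of T l] side[of T r] by (simp add: rectpath_def Let_def r1)
    qed
    ultimately have "E T = contour_integral (linepath (Complex l T) (Complex r T)) G
        - contour_integral (linepath (Complex l (-T)) (Complex r (-T))) G"
      by (simp add: E_def algebra_simps)
    also have "norm \<dots> \<le> C * 4 / T\<^sup>2 + C * 4 / (- T)\<^sup>2"
      using edge[of T] edge[of "-T"] \<open>T > 0\<close>
      by (intro order_trans[OF norm_triangle_ineq4] add_mono) auto
    finally show ?thesis by (simp add: mult.commute)
  qed
  have "(E \<longlongrightarrow> 0) at_top"
  proof (rule Lim_null_comparison)
    show "eventually (\<lambda>T. norm (E T) \<le> C * 8 / T\<^sup>2) at_top"
      using eventually_gt_at_top[of 0] by eventually_elim (rule E_bound)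
    show "((\<lambda>T. C * 8 / T\<^sup>2) \<longlongrightarrow> 0) at_top" by real_asymp
  qed
  moreover have "(E \<longlongrightarrow> vline_integral r G - vline_integral l G
      - 2 * of_real pi * \<i> * deriv F (of_nat N)) at_top"
    unfolding E_def V_def vline_integral_def
    using vline_csc_kernel_integrable[OF F bound, of N]
      vline_csc_kernel_integrable[OF F bound, of "Suc N"]
    by (intro tendsto_intros integral_symmetric_interval_tendsto)
       (auto simp: vline_integrable_def G_def l_def r_def)
  ultimately have "0 = vline_integral r G - vline_integral l G
      - 2 * of_real pi * \<i> * deriv F (of_nat N)"
    by (intro tendsto_unique) auto
  thus ?thesis by (simp add: G_def l_def r_def)
qed

text \<open>
  The increments of the line integrals telescope from the line at \<open>-1/2\<close> to the limit 0, so
  convergence of the series comes together with its value.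
\<close>
theorem vline_csc_kernel_sums:
  assumes F: "F holomorphic_on {z. Re z > -1}"
    and bound: "\<And>z. Re z \<ge> -1/2 \<Longrightarrow> norm (F z) \<le> C / norm (z + 1) ^ 2"
  shows "(\<lambda>t. deriv F (of_nat t)) sums
     (- (1 / (2 * of_real pi * \<i>) * vline_integral (-1/2) (\<lambda>z. F z * csc_kernel z)))"
proof -
  define I where "I N = vline_integral (real N - 1/2) (\<lambda>z. F z * csc_kernel z)" for N
  have "I \<longlonglongrightarrow> 0"
    unfolding I_def by (rule vline_csc_kernel_tendsto_0[OF assms])
  hence "(\<lambda>N. I (Suc N) - I N) sums (0 - I 0)" by (rule telescope_sums)
  hence "(\<lambda>N. 2 * of_real pi * \<i> * deriv F (of_nat N)) sums (- I 0)"
    using vline_csc_kernel_shift[OF assms] by (simp add: I_def)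
  from sums_mult[OF this, of "1 / (2 * of_real pi * \<i>)"] show ?thesis
    by (simp add: I_def)
qed

section \<open>Partial fractions\<close>

text \<open>
  Division by \<open>(x - c)\<^bsup>M+1\<^esup> Q\<close> turns this identity into one step of the expansion: \<open>\<alpha>\<close> is the
  coefficient of \<open>1 / (x - c)\<^bsup>M+1\<^esup>\<close>, and \<open>P'\<close> is the numerator of a proper fraction in which the
  order of the pole at \<open>c\<close> has dropped by one.
\<close>
lemma split_off_pole:
  fixes P Q :: "'a::field poly"
  assumes "poly Q c \<noteq> 0" "degree P \<le> M + degree Q"
  obtains \<alpha> P' where "P = smult \<alpha> Q + [:-c, 1:] * P'" "P' = 0 \<or> degree P' < M + degree Q"
proof -
  define \<alpha> where "\<alpha> = poly P c / poly Q c"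
  have "poly (P - smult \<alpha> Q) c = 0" using assms by (simp add: \<alpha>_def)
  then obtain P' where P': "P - smult \<alpha> Q = [:-c, 1:] * P'"
    unfolding poly_eq_0_iff_dvd by (auto elim: dvdE)
  have "degree P' < M + degree Q" if "P' \<noteq> 0"
  proof -
    have "Suc (degree P') = degree (P - smult \<alpha> Q)"
      using that by (subst P', subst degree_mult_eq) auto
    also have "\<dots> \<le> M + degree Q"
      using assms by (intro degree_diff_le order_trans[OF degree_smult_le]) auto
    finally show ?thesis by simp
  qed
  moreover have "P = smult \<alpha> Q + [:-c, 1:] * P'" by (subst P'[symmetric]) simp
  ultimately show ?thesis using that by blast
qed

text \<open>
  The poles are indexed by \<open>c\<close> and their orders are given by \<open>m\<close>.  The outer induction adds
  one pole at a time, the inner one raises its order.  Zero needs its own disjunct because it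
  has degree 0, while a sum of no fractions requires a vanishing numerator.
\<close>
theorem partial_fraction_expansion:
  fixes P :: "'a::field poly" and c :: "'b \<Rightarrow> 'a" and m :: "'b \<Rightarrow> nat"
  assumes "finite I" "inj_on c I" "P = 0 \<or> degree P < (\<Sum>k\<in>I. m k)"
  shows "\<exists>A. \<forall>x. (\<forall>k\<in>I. x \<noteq> c k) \<longrightarrow>
           poly P x / (\<Prod>k\<in>I. (x - c k) ^ m k) = (\<Sum>k\<in>I. \<Sum>l=1..m k. A k l / (x - c k) ^ l)"
  using assms
proof (induction I arbitrary: P rule: finite_induct)
  case (insert i I)
  define Q where "Q = (\<Prod>k\<in>I. [:- c k, 1:] ^ m k)"
  have Q: "poly Q x = (\<Prod>k\<in>I. (x - c k) ^ m k)" for x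
    by (simp add: Q_def poly_prod)
  have "degree Q = (\<Sum>k\<in>I. degree ([:- c k, 1:] ^ m k))"
    unfolding Q_def by (rule degree_prod_eq_sum_degree) auto
  hence deg_Q: "degree Q = (\<Sum>k\<in>I. m k)" by (simp add: degree_linear_power)
  have "poly Q (c i) \<noteq> 0"
    using insert.prems(1) insert.hyps by (auto simp: Q)
  have main: "\<exists>B A. \<forall>x. (\<forall>k\<in>insert i I. x \<noteq> c k) \<longrightarrow>
      poly P x / ((x - c i) ^ M * poly Q x)
        = (\<Sum>l=1..M. B l / (x - c i) ^ l) + (\<Sum>k\<in>I. \<Sum>l=1..m k. A k l / (x - c k) ^ l)"
    if "P = 0 \<or> degree P < M + degree Q" for M P
    using that
  proof (induction M arbitrary: P)
    case 0
    with insert.IH[of P] insert.prems(1) show ?case by (auto simp: deg_Q Q)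
  next
    case (Suc M)
    hence "degree P \<le> M + degree Q" by auto
    from split_off_pole[OF \<open>poly Q (c i) \<noteq> 0\<close> this]
    obtain \<alpha> P' where P': "P = smult \<alpha> Q + [:- c i, 1:] * P'"
      and deg: "P' = 0 \<or> degree P' < M + degree Q"
      by blast
    from Suc.IH[OF deg] obtain B A where BA: "\<And>x. (\<forall>k\<in>insert i I. x \<noteq> c k) \<Longrightarrow>
        poly P' x / ((x - c i) ^ M * poly Q x)
        = (\<Sum>l=1..M. B l / (x - c i) ^ l) + (\<Sum>k\<in>I. \<Sum>l=1..m k. A k l / (x - c k) ^ l)"
      by blast
    have "poly P x / ((x - c i) ^ Suc M * poly Q x)
        = (\<Sum>l=1..Suc M. (B(Suc M := \<alpha>)) l / (x - c i) ^ l)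
          + (\<Sum>k\<in>I. \<Sum>l=1..m k. A k l / (x - c k) ^ l)"
      if x: "\<forall>k\<in>insert i I. x \<noteq> c k" for x
    proof -
      have nz: "poly Q x \<noteq> 0" "x - c i \<noteq> 0"
        using x insert.hyps by (auto simp: Q)
      have "poly P x / ((x - c i) ^ Suc M * poly Q x)
          = \<alpha> / (x - c i) ^ Suc M + poly P' x / ((x - c i) ^ M * poly Q x)"
        using nz by (simp add: P' field_simps)
      also have "poly P' x / ((x - c i) ^ M * poly Q x)
          = (\<Sum>l=1..M. B l / (x - c i) ^ l) + (\<Sum>k\<in>I. \<Sum>l=1..m k. A k l / (x - c k) ^ l)"
        by (rule BA[OF x])
      also have "(\<Sum>l=1..M. B l / (x - c i) ^ l) = (\<Sum>l=1..M. (B(Suc M := \<alpha>)) l / (x - c i) ^ l)"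
        by (intro sum.cong) auto
      finally show ?thesis by (simp add: add_ac)
    qed
    thus ?case by blast
  qed
  have "P = 0 \<or> degree P < m i + degree Q"
    using insert.prems(2) insert.hyps by (simp add: deg_Q)
  from main[OF this] obtain B A where BA: "\<And>x. (\<forall>k\<in>insert i I. x \<noteq> c k) \<Longrightarrow>
      poly P x / ((x - c i) ^ m i * poly Q x)
        = (\<Sum>l=1..m i. B l / (x - c i) ^ l) + (\<Sum>k\<in>I. \<Sum>l=1..m k. A k l / (x - c k) ^ l)"
    by blast
  show ?case
  proof (intro exI[of _ "A(i := B)"] allI impI)
    fix x assume x: "\<forall>k\<in>insert i I. x \<noteq> c k"
    have "(\<Sum>k\<in>I. \<Sum>l=1..m k. (A(i := B)) k l / (x - c k) ^ l)
        = (\<Sum>k\<in>I. \<Sum>l=1..m k. A k l / (x - c k) ^ l)"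
      using insert.hyps by (intro sum.cong) auto
    with BA[OF x] insert.hyps
    show "poly P x / (\<Prod>k\<in>insert i I. (x - c k) ^ m k)
        = (\<Sum>k\<in>insert i I. \<Sum>l=1..m k. (A(i := B)) k l / (x - c k) ^ l)"
      by (simp add: Q)
  qed
qed auto

section \<open>Rational functions with poles at negative integers\<close>

text \<open>
  Away from the origin every lower power of \<open>w\<close> is dominated by a multiple of \<open>w\<^bsup>d\<^esup>\<close>.  The radius
  1/2 is the distance from the pole \<open>-1\<close> to the line \<open>Re z = -1/2\<close>.
\<close>
lemma poly_norm_le:
  fixes P :: "'a::real_normed_field poly"
  assumes "degree P \<le> d"
  shows "\<exists>C\<ge>0. \<forall>w. norm w \<ge> 1/2 \<longrightarrow> norm (poly P w) \<le> C * norm w ^ d"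
proof (intro exI conjI allI impI)
  define C where "C = (\<Sum>i\<le>degree P. norm (coeff P i) * 2 ^ d)"
  show "C \<ge> 0" unfolding C_def by (intro sum_nonneg) auto
  fix w :: 'a assume w: "norm w \<ge> 1/2"
  have "norm (poly P w) \<le> (\<Sum>i\<le>degree P. norm (coeff P i * w ^ i))"
    unfolding poly_altdef by (rule norm_sum)
  also have "\<dots> \<le> (\<Sum>i\<le>degree P. norm (coeff P i) * 2 ^ d * norm w ^ d)"
  proof (intro sum_mono)
    fix i assume "i \<in> {..degree P}"
    hence i: "i \<le> d" using assms by simp
    have "norm w ^ i * 1 \<le> norm w ^ i * (2 * norm w) ^ (d - i)"
      using w by (intro mult_left_mono one_le_power) auto
    also have "\<dots> = 2 ^ (d - i) * (norm w ^ i * norm w ^ (d - i))"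
      by (simp add: power_mult_distrib)
    also have "norm w ^ i * norm w ^ (d - i) = norm w ^ d"
      using i by (simp flip: power_add)
    also have "2 ^ (d - i) * norm w ^ d \<le> 2 ^ d * norm w ^ d"
      by (intro mult_right_mono power_increasing) auto
    finally have "norm w ^ i \<le> 2 ^ d * norm w ^ d" by simp
    thus "norm (coeff P i * w ^ i) \<le> norm (coeff P i) * 2 ^ d * norm w ^ d"
      by (simp add: norm_mult norm_power mult_left_mono mult.assoc)
  qed
  finally show "norm (poly P w) \<le> C * norm w ^ d"
    by (simp add: C_def sum_distrib_right)
qed

text \<open>
  For \<open>Re z \<ge> -1/2\<close> every factor \<open>z + k + 1\<close> of the denominator is at least as large as
  \<open>z + 1\<close>, and \<open>\<bar>z + 1\<bar> \<ge> 1/2\<close>.  Numerator and denominator can therefore both be compared with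
  powers of \<open>\<bar>z + 1\<bar>\<close>, and the degree gap gives the quadratic decay.
\<close>
lemma rational_function_right_half_plane:
  fixes P :: "complex poly" and m :: "nat \<Rightarrow> nat"
  assumes F: "\<And>z. \<forall>k\<le>n. z \<noteq> - of_nat (k + 1) \<Longrightarrow>
                F z = poly P z / (\<Prod>k\<le>n. (z + of_nat k + 1) ^ m k)"
    and deg: "degree P + 2 \<le> (\<Sum>k\<le>n. m k)"
  shows "F holomorphic_on {z. Re z > -1}"
    and "\<exists>C. \<forall>z. Re z \<ge> -1/2 \<longrightarrow> norm (F z) \<le> C / norm (z + 1) ^ 2"
proof -
  have np: "z \<noteq> - of_nat (k + 1)" if "Re z > -1" for z k
    using that by (auto simp: complex_eq_iff)
  have nz: "z + of_nat k + 1 \<noteq> 0" if "Re z > -1" for z k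
    using np[OF that, of k] by (auto simp: add_eq_0_iff algebra_simps)
  have "(\<lambda>z. poly P z / (\<Prod>k\<le>n. (z + of_nat k + 1) ^ m k)) holomorphic_on {z. Re z > -1}"
    using nz by (intro holomorphic_intros) auto
  thus "F holomorphic_on {z. Re z > -1}"
    using F np by (subst holomorphic_cong[OF refl]) auto
  define M where "M = (\<Sum>k\<le>n. m k)"
  \<comment> \<open>Expanding \<open>P\<close> in powers of \<open>z + 1\<close> keeps its degree.\<close>
  have "degree (pcompose P [:-1, 1:]) \<le> M - 2"
    using deg by (simp add: degree_pcompose M_def)
  from poly_norm_le[OF this] obtain C where C: "C \<ge> 0"
    "\<And>w. norm w \<ge> 1/2 \<Longrightarrow> norm (poly (pcompose P [:-1, 1:]) w) \<le> C * norm w ^ (M - 2)"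
    by blast
  have "norm (F z) \<le> C / norm (z + 1) ^ 2" if z: "Re z \<ge> -1/2" for z
  proof -
    have half: "1/2 \<le> norm (z + 1)" using complex_Re_le_cmod[of "z + 1"] z by simp
    have "norm (z + 1) ^ M = (\<Prod>k\<le>n. norm (z + 1) ^ m k)"
      by (simp add: M_def power_sum)
    also have "\<dots> \<le> (\<Prod>k\<le>n. norm (z + of_nat k + 1) ^ m k)"
    proof (intro prod_mono conjI power_mono)
      fix k
      have "\<bar>Re (z + 1)\<bar> \<le> \<bar>Re (z + of_nat k + 1)\<bar>" using z by simp
      thus "norm (z + 1) \<le> norm (z + of_nat k + 1)"
        unfolding cmod_def by (intro real_sqrt_le_mono add_mono) (auto simp: abs_le_square_iff)
    qed auto
    finally have den: "norm (z + 1) ^ M \<le> norm (\<Prod>k\<le>n. (z + of_nat k + 1) ^ m k)"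
      by (simp add: norm_power flip: prod_norm)
    have num: "norm (poly P z) \<le> C * norm (z + 1) ^ (M - 2)"
      using C(2)[OF half] by (simp add: poly_pcompose)
    have pos: "0 < norm (z + 1)" using half by linarith
    have "F z = poly P z / (\<Prod>k\<le>n. (z + of_nat k + 1) ^ m k)"
      using z np by (intro F) auto
    hence "norm (F z) \<le> (C * norm (z + 1) ^ (M - 2)) / norm (z + 1) ^ M"
      unfolding norm_divide using C(1) pos
      by (simp only: norm_divide) (intro frac_le num den mult_nonneg_nonneg zero_less_power; simp)
    also have "M = (M - 2) + 2" using deg by (simp add: M_def)
    hence "norm (z + 1) ^ M = norm (z + 1) ^ (M - 2) * norm (z + 1) ^ 2"
      by (metis power_add)
    hence "(C * norm (z + 1) ^ (M - 2)) / norm (z + 1) ^ M = C / norm (z + 1) ^ 2"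
      using half by (simp add: field_simps)
    finally show ?thesis .
  qed
  thus "\<exists>C. \<forall>z. Re z \<ge> -1/2 \<longrightarrow> norm (F z) \<le> C / norm (z + 1) ^ 2" by blast
qed


section \<open>Summing the derivative of a partial fraction expansion\<close>

lemma inverse_power_tail_sums:
  assumes "s \<ge> 2"
  shows "(\<lambda>t. 1 / (of_nat t + of_nat k + 1) ^ s)
           sums ((\<Sum>m. 1 / of_nat (Suc m) ^ s) - gharm s k)"
proof -
  have "summable (\<lambda>m. inverse (of_nat m ^ s) :: complex)"
    using assms by (rule inverse_power_summable)
  hence "summable (\<lambda>m. 1 / of_nat (Suc m) ^ s :: complex)"
    by (subst (asm) summable_Suc_iff [symmetric]) (simp add: inverse_eq_divide)
  hence "(\<lambda>m. 1 / of_nat (Suc m) ^ s :: complex) sums (\<Sum>m. 1 / of_nat (Suc m) ^ s)"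
    by (rule summable_sums)
  from sums_split_initial_segment[OF this, of k]
  have "(\<lambda>t. 1 / of_nat (Suc (t + k)) ^ s)
      sums ((\<Sum>m. 1 / of_nat (Suc m) ^ s) - (\<Sum>m<k. 1 / of_nat (Suc m) ^ s :: complex))" .
  moreover have "(\<Sum>m<k. 1 / of_nat (Suc m) ^ s) = gharm s k"
    unfolding gharm_def by (intro sum.reindex_bij_witness[of _ "\<lambda>l. l - 1" Suc]) auto
  ultimately show ?thesis by (simp add: add_ac)
qed

lemma zeta_3: "zeta 3 = (\<Sum>m. 1 / of_nat (Suc m) ^ 3)"
proof -
  have "of_nat (Suc m) powr (- 3 :: complex) = 1 / of_nat (Suc m) ^ 3" for m
    using powr_nat'[of "of_nat (Suc m)" 3] by (simp add: powr_minus inverse_eq_divide)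
  thus ?thesis unfolding zeta_def by simp
qed

text \<open>
  Multiplying the expansion by \<open>t\<close> and letting \<open>t\<close> run to infinity turns the right-hand side into
  the sum of the \<open>a k\<close>, while the decay of \<open>F\<close> makes the left-hand side tend to 0.  This removes
  the multiple of \<open>\<zeta>(2)\<close> that termwise summation produces.
\<close>
lemma partial_fraction_deriv_sums:
  fixes a b :: "nat \<Rightarrow> complex"
  assumes F: "\<And>z. Re z > -1 \<Longrightarrow>
      F z = (\<Sum>k\<le>n. a k / (z + of_nat k + 1)) - (\<Sum>k<N. b k / (z + of_nat k + 1)\<^sup>2)"
    and bound: "\<And>z. Re z \<ge> -1/2 \<Longrightarrow> norm (F z) \<le> C / norm (z + 1) ^ 2"
  shows "(\<lambda>t. deriv F (of_nat t)) sums
     (2 * (\<Sum>k<N. b k) * zeta 3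
        - (2 * (\<Sum>k<N. b k * gharm 3 k) - (\<Sum>k\<le>n. a k * gharm 2 k)))"
proof -
  define Z :: complex where "Z = (\<Sum>m. 1 / of_nat (Suc m) ^ 2)"
  have frac: "(\<lambda>t. (of_nat t :: complex) * (c / (of_nat t + of_nat k + 1))) \<longlonglongrightarrow> c" for c k
  proof -
    have "(\<lambda>t. real t / (real t + real k + 1)) \<longlonglongrightarrow> 1" by real_asymp
    hence "(\<lambda>t. complex_of_real (real t / (real t + real k + 1)) * c) \<longlonglongrightarrow> of_real 1 * c"
      by (intro tendsto_intros)
    thus ?thesis by (simp add: mult_ac)
  qed
  have frac2: "(\<lambda>t. (of_nat t :: complex) * (c / (of_nat t + of_nat k + 1)\<^sup>2)) \<longlonglongrightarrow> 0" for c k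
  proof -
    have "(\<lambda>t. real t / (real t + real k + 1)\<^sup>2) \<longlonglongrightarrow> 0" by real_asymp
    hence "(\<lambda>t. complex_of_real (real t / (real t + real k + 1)\<^sup>2) * c) \<longlonglongrightarrow> of_real 0 * c"
      by (intro tendsto_intros)
    thus ?thesis by (simp add: mult_ac)
  qed
  have "(\<lambda>t. of_nat t * F (of_nat t)) \<longlonglongrightarrow> (\<Sum>k\<le>n. a k) - (\<Sum>k<N. 0)"
  proof -
    have "of_nat t * F (of_nat t)
        = (\<Sum>k\<le>n. of_nat t * (a k / (of_nat t + of_nat k + 1)))
          - (\<Sum>k<N. of_nat t * (b k / (of_nat t + of_nat k + 1)\<^sup>2))" for t
      by (subst F) (simp_all add: right_diff_distrib sum_distrib_left)
    thus ?thesis by (simp only:) (intro tendsto_diff tendsto_sum frac frac2)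
  qed
  moreover have "(\<lambda>t. of_nat t * F (of_nat t)) \<longlonglongrightarrow> 0"
  proof (rule Lim_null_comparison)
    show "eventually (\<lambda>t. norm (of_nat t * F (of_nat t)) \<le> real t * (C / (real t + 1)\<^sup>2)) sequentially"
    proof (rule always_eventually, rule allI)
      fix t
      have "norm (of_nat t + 1 :: complex) = norm (of_nat (Suc t) :: complex)" by (simp add: add_ac)
      also have "\<dots> = real t + 1" by (simp only: norm_of_nat)
      finally show "norm (of_nat t * F (of_nat t)) \<le> real t * (C / (real t + 1)\<^sup>2)"
        using bound[of "of_nat t"] by (simp add: norm_mult mult_left_mono del: times_divide_eq_right)
    qed
    show "(\<lambda>t. real t * (C / (real t + 1)\<^sup>2)) \<longlonglongrightarrow> 0" by real_asymp
  qed
  ultimately have a_sum: "(\<Sum>k\<le>n. a k) = 0"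
    using LIMSEQ_unique by fastforce
  have deriv: "deriv F (of_nat t) = 2 * (\<Sum>k<N. b k * (1 / (of_nat t + of_nat k + 1) ^ 3))
      - (\<Sum>k\<le>n. a k * (1 / (of_nat t + of_nat k + 1) ^ 2))" for t
  proof -
    define G where "G z = (\<Sum>k\<le>n. a k / (z + of_nat k + 1))
        - (\<Sum>k<N. b k / (z + of_nat k + 1)\<^sup>2)" for z
    have nz: "of_nat t + of_nat k + 1 \<noteq> (0::complex)" for k
      by (metis of_nat_add of_nat_1 of_nat_neq_0 of_nat_Suc add.commute add.left_commute)
    have "eventually (\<lambda>z. z \<in> {z. Re z > -1}) (nhds (of_nat t :: complex))"
      by (intro eventually_nhds_in_open) (auto simp: open_halfspace_Re_gt)
    hence "eventually (\<lambda>z. F z = G z) (nhds (of_nat t))"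
      by eventually_elim (simp add: F G_def)
    hence "deriv F (of_nat t) = deriv G (of_nat t)" by (intro deriv_cong_ev) auto
    also have "\<dots> = (\<Sum>k\<le>n. - a k / (of_nat t + of_nat k + 1)\<^sup>2)
        - (\<Sum>k<N. - 2 * b k / (of_nat t + of_nat k + 1) ^ 3)"
    proof (rule DERIV_imp_deriv)
      have d1: "((\<lambda>z. a k / (z + of_nat k + 1)) has_field_derivative
          - a k / (of_nat t + of_nat k + 1)\<^sup>2) (at (of_nat t))" for k
        using nz[of k] by (auto intro!: derivative_eq_intros simp: power2_eq_square)
      have d2: "((\<lambda>z. b k / (z + of_nat k + 1)\<^sup>2) has_field_derivative
          - 2 * b k / (of_nat t + of_nat k + 1) ^ 3) (at (of_nat t))" for k
      proof -
        define w :: complex where "w = of_nat t + of_nat k + 1"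
        have "w \<noteq> 0" using nz[of k] by (simp add: w_def)
        hence "(0 * w\<^sup>2 - b k * (of_nat 2 * (1 * w ^ (2 - 1)))) / (w\<^sup>2 * w\<^sup>2) = - 2 * b k / w ^ 3"
          by (simp add: power2_eq_square power3_eq_cube mult_ac)
        moreover have "((\<lambda>z. z + of_nat k + 1) has_field_derivative 1) (at (of_nat t :: complex))"
          by (auto intro!: derivative_eq_intros)
        note DERIV_divide[OF DERIV_const DERIV_power[OF this, of 2], folded w_def, of "b k"]
        ultimately show ?thesis using \<open>w \<noteq> 0\<close> by (simp flip: w_def)
      qed
      show "(G has_field_derivative (\<Sum>k\<le>n. - a k / (of_nat t + of_nat k + 1)\<^sup>2)
        - (\<Sum>k<N. - 2 * b k / (of_nat t + of_nat k + 1) ^ 3)) (at (of_nat t))"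
        unfolding G_def by (intro DERIV_diff DERIV_sum d1 d2)
    qed
    finally show ?thesis by (simp add: sum_negf sum_distrib_left)
  qed
  have "(\<lambda>t. deriv F (of_nat t)) sums
     (2 * (\<Sum>k<N. b k * (zeta 3 - gharm 3 k)) - (\<Sum>k\<le>n. a k * (Z - gharm 2 k)))"
    unfolding deriv zeta_3 Z_def
    by (intro sums_diff sums_mult sums_sum inverse_power_tail_sums) auto
  also have "(\<Sum>k\<le>n. a k * (Z - gharm 2 k)) = (\<Sum>k\<le>n. a k) * Z - (\<Sum>k\<le>n. a k * gharm 2 k)"
    by (simp add: right_diff_distrib sum_subtractf sum_distrib_right)
  also have "2 * (\<Sum>k<N. b k * (zeta 3 - gharm 3 k)) - \<dots>
      = 2 * (\<Sum>k<N. b k) * zeta 3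
        - (2 * (\<Sum>k<N. b k * gharm 3 k) - (\<Sum>k\<le>n. a k * gharm 2 k))"
    by (simp add: a_sum right_diff_distrib sum_subtractf sum_distrib_right)
  finally show ?thesis .
qed

section \<open>The linear forms in 1 and \<open>\<zeta>(3)\<close>\<close>

lemma remove_sings_eq_continuous:
  assumes "isCont g z" "eventually (\<lambda>w. f w = g w) (at z)"
  shows "remove_sings f z = g z"
proof (rule remove_sings_eqI)
  have "g \<midarrow>z\<rightarrow> g z" using assms(1) by (simp add: isCont_def)
  thus "f \<midarrow>z\<rightarrow> g z" using assms(2) by (subst tendsto_cong) auto
qed

text \<open>
  For \<open>n \<ge> 1\<close> the Pochhammer symbol \<open>(-t)\<^sub>n\<close> contains the factor \<open>t - n + 1\<close>, whose square
  cancels that factor in the denominator and, for \<open>i = 1\<close>, leaves one copy in the numerator;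
  for \<open>i = 3\<close> the order of the pole at \<open>-(n+1)\<close> drops to one.  For \<open>n = 0\<close> there is nothing to
  cancel, \<open>t - n + 1\<close> coincides with \<open>t + 1\<close>, and the denominator is the third or fourth power
  of \<open>t + 1\<close>.
\<close>
lemma R1_rational:
  fixes i j n \<rho> \<upsilon> chi \<psi> :: nat and \<theta> :: int
  assumes "i \<in> {1, 2, 3, 4}"
  obtains P m where
    "\<And>z. \<forall>k\<le>n. z \<noteq> - of_nat (k + 1) \<Longrightarrow>
       R1 \<rho> \<theta> \<upsilon> chi \<psi> i j n z = poly P z / (\<Prod>k\<le>n. (z + of_nat k + 1) ^ m k)"
    "degree P + 2 \<le> (\<Sum>k\<le>n. m k)"
    "n \<ge> 1 \<Longrightarrow> m = (\<lambda>k. if i = 3 \<and> k = n then 1 else 2)"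
proof -
  define L :: "complex poly" where "L =
     smult (kdelta 1 j) [:of_nat n + of_nat \<rho>, 1:]
     + smult (kdelta 2 j) [:of_int \<theta> * of_nat n + 1, 1:]
     + smult (kdelta 3 j) [:- of_nat chi * of_nat n - of_nat \<psi>, of_nat \<upsilon>:]"
  define e :: nat where "e = kdelta i 2 + 1"
  define P where "P = (if n = 0 then 1
      else (\<Prod>k<n-1. [:of_nat k, -1:])\<^sup>2 * [:1 - of_nat n, 1:] ^ kdelta i 1) * L ^ e"
  define m :: "nat \<Rightarrow> nat" where
    "m = (\<lambda>k. if n = 0 then 4 - kdelta i 1 - kdelta i 3 else if i = 3 \<and> k = n then 1 else 2)"
  let ?f = "\<lambda>t. R_base n t * theta_fun \<rho> \<theta> \<upsilon> chi \<psi> i j n t"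
  let ?g = "\<lambda>z. poly P z / (\<Prod>k\<le>n. (z + of_nat k + 1) ^ m k)"
  define poles where "poles = (\<lambda>k. - of_nat (k + 1) :: complex) ` {..n}"
  have L: "kdelta 1 j * (t + of_nat n + of_nat \<rho>)
      + kdelta 2 j * (t + of_int \<theta> * of_nat n + 1)
      + kdelta 3 j * (of_nat \<upsilon> * t - of_nat chi * of_nat n - of_nat \<psi>) = poly L t" for t
    by (simp add: L_def algebra_simps)
  have shift: "z + of_nat k + 1 = 0 \<longleftrightarrow> z = - of_nat (k + 1)" for z :: complex and k :: nat
    using add_eq_0_iff2[of z "of_nat (k + 1)"] by (simp add: add_ac)
  have eq: "?f t = ?g t" if t: "t \<notin> insert (of_nat n - 1) poles" for t
  proof -
    have nz: "t + of_nat k + 1 \<noteq> 0" if "k \<le> n" for k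
      using t that unfolding shift by (auto simp: poles_def)
    have den: "pochhammer (t + 1) (n + 1) = (\<Prod>k\<le>n. t + of_nat k + 1)"
      unfolding pochhammer_prod by (intro prod.cong) (auto simp: algebra_simps)
    show ?thesis
    proof (cases n)
      case 0
      define w where "w = t + 1"
      have "w \<noteq> 0" using nz[of 0] by (simp add: w_def)
      have "?f t = 1 / w\<^sup>2 * (poly L t ^ e / (w powi (2 - kdelta i 1) * w powi (- kdelta i 3)))"
        unfolding R_base_def theta_fun_def L by (simp add: 0 e_def w_def)
      also have "\<dots> = poly L t ^ e / w ^ (4 - kdelta i 1 - kdelta i 3)"
        using assms \<open>w \<noteq> 0\<close>
        by (auto simp: kdelta_def power_int_minus field_simps eval_nat_numeral)
      finally show ?thesis by (simp add: 0 P_def m_def w_def)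
    next
      case (Suc q)
      define p D E u where "p = (\<Prod>k<q. of_nat k - t)" and "D = (\<Prod>k\<le>q. t + of_nat k + 1)"
        and "E = t + of_nat n + 1" and "u = t - of_nat n + 1"
      have nz': "D \<noteq> 0" "E \<noteq> 0" "u \<noteq> 0"
        using nz nz[of n] t Suc unfolding D_def E_def by (simp_all, auto simp: u_def algebra_simps)
      have "pochhammer (- t) n = (\<Prod>k<q. of_nat k - t) * (of_nat q - t)"
        unfolding Suc pochhammer_prod by (simp add: atLeast0LessThan)
      also have "of_nat q - t = - u" by (simp add: u_def Suc)
      finally have num: "pochhammer (- t) n = - (p * u)" by (simp add: p_def)
      have den': "pochhammer (t + 1) (n + 1) = D * E"
        unfolding den by (simp add: Suc D_def E_def)
      have "(\<Prod>k\<le>q. (t + of_nat k + 1) ^ m k) = (\<Prod>k\<le>q. (t + of_nat k + 1) ^ 2)"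
        by (intro prod.cong) (auto simp: m_def Suc)
      hence g_den: "(\<Prod>k\<le>n. (t + of_nat k + 1) ^ m k) = D\<^sup>2 * E ^ (if i = 3 then 1 else 2)"
        by (simp add: Suc D_def E_def m_def prod_power_distrib)
      have g_num: "poly P t = p\<^sup>2 * u ^ kdelta i 1 * poly L t ^ e"
        by (simp add: P_def Suc p_def u_def poly_prod algebra_simps)
      have "?f t = (p * u)\<^sup>2 / (D * E)\<^sup>2
          * (poly L t ^ e / (u powi (2 - kdelta i 1) * E powi (- kdelta i 3)))"
        unfolding R_base_def theta_fun_def L num den' u_def [symmetric] E_def [symmetric]
        by (simp add: e_def)
      also have "\<dots> = p\<^sup>2 * u ^ kdelta i 1 * poly L t ^ e / (D\<^sup>2 * E ^ (if i = 3 then 1 else 2))"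
        using assms nz'
        by (auto simp: kdelta_def power_int_minus power2_eq_square field_simps)
      finally show ?thesis by (simp only: g_num g_den)
    qed
  qed
  have R1: "R1 \<rho> \<theta> \<upsilon> chi \<psi> i j n z = ?g z" if z: "\<forall>k\<le>n. z \<noteq> - of_nat (k + 1)" for z
    unfolding R1_def
  proof (rule remove_sings_eq_continuous)
    have "z + of_nat k + 1 \<noteq> 0" if "k \<le> n" for k
      using z that unfolding shift by auto
    thus "isCont ?g z" by (intro continuous_intros) auto
    have "finite (insert (of_nat n - 1) poles)" by (simp add: poles_def)
    hence "eventually (\<lambda>w. w \<notin> insert (of_nat n - 1) poles) (at z)"
      using islimpt_finite[of "insert (of_nat n - 1) poles" z]
      unfolding islimpt_iff_eventually by blast
    thus "eventually (\<lambda>w. ?f w = ?g w) (at z)"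
      by eventually_elim (rule eq)
  qed
  have deg_L: "degree L \<le> 1"
    unfolding L_def by (intro degree_add_le order_trans[OF degree_smult_le]) auto
  have deg_Le: "degree (L ^ e) \<le> e"
    using order_trans[OF degree_power_le mult_le_mono1[OF deg_L]] by simp
  have "degree P + 2 \<le> (\<Sum>k\<le>n. m k)"
  proof (cases n)
    case 0
    thus ?thesis using assms deg_Le by (auto simp: P_def m_def e_def kdelta_def)
  next
    case (Suc q)
    have "degree (\<Prod>k<q. [:of_nat k, -1 :: complex:]) \<le> (\<Sum>k<q. degree [:of_nat k, -1 :: complex:])"
      using degree_prod_sum_le[of "{..<q}" "\<lambda>k. [:of_nat k, -1 :: complex:]"] by (simp add: o_def)
    hence d1: "degree ((\<Prod>k<q. [:of_nat k, -1 :: complex:])\<^sup>2) \<le> 2 * q"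
      using degree_power_le[of "\<Prod>k<q. [:of_nat k, -1 :: complex:]" 2] by simp
    have d2: "degree ([:1 - of_nat n, 1 :: complex:] ^ kdelta i 1) \<le> kdelta i 1"
      by (simp add: degree_linear_power)
    have P: "P = (\<Prod>k<q. [:of_nat k, -1:])\<^sup>2 * [:1 - of_nat n, 1:] ^ kdelta i 1 * L ^ e"
      using Suc by (simp add: P_def del: mult_pCons_left mult_pCons_right)
    have "degree P \<le> 2 * q + kdelta i 1 + e"
      unfolding P by (intro order_trans[OF degree_mult_le] add_mono d1 d2 deg_Le)
    moreover have "(\<Sum>k\<le>q. m k) = (\<Sum>k\<le>q. 2)"
      by (intro sum.cong) (auto simp: m_def Suc)
    hence "(\<Sum>k\<le>n. m k) = 2 * q + 2 + (if i = 3 then 1 else 2)"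
      by (simp add: Suc m_def)
    ultimately show ?thesis using assms by (auto simp: e_def kdelta_def)
  qed
  with R1 show ?thesis by (intro that[of P m]) (auto simp: m_def)
qed

lemma is_pf_expansion_exists:
  fixes i j n \<rho> \<upsilon> chi \<psi> :: nat and \<theta> :: int
  assumes "i \<in> {1, 2, 3, 4}" "n \<ge> 1"
  shows "\<exists>a b. is_pf_expansion \<rho> \<theta> \<upsilon> chi \<psi> i j n a b"
proof -
  obtain P m where P: "\<And>z. \<forall>k\<le>n. z \<noteq> - of_nat (k + 1) \<Longrightarrow>
       R1 \<rho> \<theta> \<upsilon> chi \<psi> i j n z = poly P z / (\<Prod>k\<le>n. (z + of_nat k + 1) ^ m k)"
    and deg: "degree P + 2 \<le> (\<Sum>k\<le>n. m k)"
    and "n \<ge> 1 \<Longrightarrow> m = (\<lambda>k. if i = 3 \<and> k = n then 1 else 2)"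
    by (rule R1_rational[OF assms(1), where n = n and j = j and \<rho> = \<rho> and \<theta> = \<theta>
          and \<upsilon> = \<upsilon> and chi = chi and \<psi> = \<psi>]) (rule that)
  hence m: "m = (\<lambda>k. if i = 3 \<and> k = n then 1 else 2)" using assms(2) by simp
  have "inj_on (\<lambda>k. - of_nat (k + 1) :: complex) {..n}" by (auto simp: inj_on_def)
  moreover have "P = 0 \<or> degree P < (\<Sum>k\<in>{..n}. m k)" using deg by auto
  ultimately obtain A where A: "\<And>x. \<forall>k\<in>{..n}. x \<noteq> - of_nat (k + 1) \<Longrightarrow>
      poly P x / (\<Prod>k\<le>n. (x - - of_nat (k + 1)) ^ m k)
        = (\<Sum>k\<le>n. \<Sum>l=1..m k. A k l / (x - - of_nat (k + 1)) ^ l)"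
    using partial_fraction_expansion[of "{..n}" "\<lambda>k. - of_nat (k + 1)" P m] by blast
  define N where "N = n + 1 - kdelta i 3"
  have "R1 \<rho> \<theta> \<upsilon> chi \<psi> i j n t = (\<Sum>k\<le>n. A k 1 / (t + of_nat k + 1))
          - (\<Sum>k<N. - A k 2 / (t + of_nat k + 1)\<^sup>2)"
    if t: "\<forall>k\<le>n. t \<noteq> - of_nat (k + 1)" for t
  proof -
    have shift: "t - - of_nat (k + 1) = t + of_nat k + 1" for k by simp
    have "R1 \<rho> \<theta> \<upsilon> chi \<psi> i j n t = (\<Sum>k\<le>n. \<Sum>l=1..m k. A k l / (t + of_nat k + 1) ^ l)"
      using P[OF t] A[of t, unfolded shift] t by simp
    also have "\<dots> = (\<Sum>k\<le>n. A k 1 / (t + of_nat k + 1)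
        + (if k < N then A k 2 / (t + of_nat k + 1)\<^sup>2 else 0))"
      by (intro sum.cong) (auto simp: m N_def kdelta_def numeral_2_eq_2)
    also have "\<dots> = (\<Sum>k\<le>n. A k 1 / (t + of_nat k + 1))
        + (\<Sum>k\<in>{k\<in>{..n}. k < N}. A k 2 / (t + of_nat k + 1)\<^sup>2)"
      by (simp only: sum.distrib sum.inter_filter finite_atMost)
    also have "{k\<in>{..n}. k < N} = {..<N}" by (auto simp: N_def)
    finally show ?thesis by (simp add: sum_negf)
  qed
  hence "is_pf_expansion \<rho> \<theta> \<upsilon> chi \<psi> i j n (\<lambda>k. A k 1) (\<lambda>k. - A k 2)"
    unfolding is_pf_expansion_def N_def by blast
  thus ?thesis by blast
qed

text \<open>
  Termwise summation produces sums from \<open>k = 0\<close>, whereas those in \<open>p_seq\<close> start at \<open>k = 1\<close>; the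
  surplus terms carry the empty harmonic number \<open>H\<^sub>0 = 0\<close>.
\<close>
lemma r_seq_sums:
  fixes i j n \<rho> \<upsilon> chi \<psi> :: nat and \<theta> :: int
  assumes ex: "\<exists>a b. is_pf_expansion \<rho> \<theta> \<upsilon> chi \<psi> i j n a b"
    and bound: "\<And>z. Re z \<ge> -1/2 \<Longrightarrow> norm (R1 \<rho> \<theta> \<upsilon> chi \<psi> i j n z) \<le> C / norm (z + 1) ^ 2"
  shows "(\<lambda>t. R2 \<rho> \<theta> \<upsilon> chi \<psi> i j n (of_nat t)) sums r_seq \<rho> \<theta> \<upsilon> chi \<psi> i j n"
proof -
  define N where "N = n + 1 - kdelta i 3"
  define a b where "a = a_coeff \<rho> \<theta> \<upsilon> chi \<psi> i j n" and "b = b_coeff \<rho> \<theta> \<upsilon> chi \<psi> i j n"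
  have "is_pf_expansion \<rho> \<theta> \<upsilon> chi \<psi> i j n a b"
    unfolding a_def b_def a_coeff_def b_coeff_def pf_coeffs_def
    by (rule someI_ex[of "\<lambda>ab. is_pf_expansion \<rho> \<theta> \<upsilon> chi \<psi> i j n (fst ab) (snd ab)"]) (use ex in auto)
  moreover have "\<forall>k\<le>n. z \<noteq> - of_nat (k + 1)" if "Re z > -1" for z
    using that by (auto simp: complex_eq_iff)
  ultimately have "R1 \<rho> \<theta> \<upsilon> chi \<psi> i j n z = (\<Sum>k\<le>n. a k / (z + of_nat k + 1))
      - (\<Sum>k<N. b k / (z + of_nat k + 1)\<^sup>2)" if "Re z > -1" for z
    using that unfolding is_pf_expansion_def N_def by blast
  from partial_fraction_deriv_sums[OF this bound]
  have sums: "(\<lambda>t. R2 \<rho> \<theta> \<upsilon> chi \<psi> i j n (of_nat t)) sums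
     (2 * (\<Sum>k<N. b k) * zeta 3
        - (2 * (\<Sum>k<N. b k * gharm 3 k) - (\<Sum>k\<le>n. a k * gharm 2 k)))"
    by (simp add: R2_def)
  have "(\<Sum>k<N. b k * gharm 3 k) = (\<Sum>k=1..<N. b k * gharm 3 k)"
    by (intro sum.mono_neutral_right) (auto simp: gharm_def)
  moreover have "(\<Sum>k\<le>n. a k * gharm 2 k) = (\<Sum>k=1..n. a k * gharm 2 k)"
    by (intro sum.mono_neutral_right) (auto simp: gharm_def Suc_le_eq)
  ultimately have "r_seq \<rho> \<theta> \<upsilon> chi \<psi> i j n = 2 * (\<Sum>k<N. b k) * zeta 3
        - (2 * (\<Sum>k<N. b k * gharm 3 k) - (\<Sum>k\<le>n. a k * gharm 2 k))"
    unfolding r_seq_def q_seq_def p_seq_def a_def [symmetric] b_def [symmetric] N_def [symmetric]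
    by simp
  with sums show ?thesis by simp
qed

theorem lemma2p2:
  fixes i j n \<rho> \<upsilon> chi \<psi> :: nat and \<theta> :: int
  assumes "i \<in> {1, 2, 3, 4}" and "j \<in> {1, 2, 3}"
    and "\<rho> \<ge> 2" and "\<theta> \<notin> {-1, 0, 1}"
    and "\<upsilon> \<ge> 1" and "chi \<ge> \<upsilon>"
  shows "vline_integrable (-1/2) (sin_kernel_integrand \<rho> \<theta> \<upsilon> chi \<psi> i j n) \<and>
    summable (\<lambda>t. R2 \<rho> \<theta> \<upsilon> chi \<psi> i j n (of_nat t)) \<and>
    (n \<ge> 1 \<or> (\<exists>a b. is_pf_expansion \<rho> \<theta> \<upsilon> chi \<psi> i j n a b) \<longrightarrow>
       r_seq \<rho> \<theta> \<upsilon> chi \<psi> i j n =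
         - (1 / (2 * of_real pi * \<i>)
              * vline_integral (-1/2) (sin_kernel_integrand \<rho> \<theta> \<upsilon> chi \<psi> i j n))) \<and>
    - (1 / (2 * of_real pi * \<i>)
         * vline_integral (-1/2) (sin_kernel_integrand \<rho> \<theta> \<upsilon> chi \<psi> i j n))
      = (\<Sum>t. R2 \<rho> \<theta> \<upsilon> chi \<psi> i j n (of_nat t))"
proof -
  let ?F = "R1 \<rho> \<theta> \<upsilon> chi \<psi> i j n"
  let ?I = "- (1 / (2 * of_real pi * \<i>)
              * vline_integral (-1/2) (sin_kernel_integrand \<rho> \<theta> \<upsilon> chi \<psi> i j n))"
  obtain P m where P: "\<And>z. \<forall>k\<le>n. z \<noteq> - of_nat (k + 1) \<Longrightarrow>
       ?F z = poly P z / (\<Prod>k\<le>n. (z + of_nat k + 1) ^ m k)"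
    and deg: "degree P + 2 \<le> (\<Sum>k\<le>n. m k)"
    by (rule R1_rational[OF assms(1), where n = n and j = j and \<rho> = \<rho> and \<theta> = \<theta>
          and \<upsilon> = \<upsilon> and chi = chi and \<psi> = \<psi>]) (rule that)
  note holo = rational_function_right_half_plane(1)[OF P deg]
  obtain C where C: "\<And>z. Re z \<ge> -1/2 \<Longrightarrow> norm (?F z) \<le> C / norm (z + 1) ^ 2"
    using rational_function_right_half_plane(2)[OF P deg] by blast
  have kernel: "sin_kernel_integrand \<rho> \<theta> \<upsilon> chi \<psi> i j n = (\<lambda>z. ?F z * csc_kernel z)"
    by (simp add: sin_kernel_integrand_def csc_kernel_def fun_eq_iff)
  have "vline_integrable (-1/2) (sin_kernel_integrand \<rho> \<theta> \<upsilon> chi \<psi> i j n)"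
    using vline_csc_kernel_integrable[OF holo C, of 0] by (simp add: kernel)
  moreover have sums: "(\<lambda>t. R2 \<rho> \<theta> \<upsilon> chi \<psi> i j n (of_nat t)) sums ?I"
    unfolding R2_def kernel by (rule vline_csc_kernel_sums[OF holo C])
  moreover have "r_seq \<rho> \<theta> \<upsilon> chi \<psi> i j n = ?I"
    if "n \<ge> 1 \<or> (\<exists>a b. is_pf_expansion \<rho> \<theta> \<upsilon> chi \<psi> i j n a b)"
  proof -
    have "\<exists>a b. is_pf_expansion \<rho> \<theta> \<upsilon> chi \<psi> i j n a b"
      using that is_pf_expansion_exists[OF assms(1)] by blast
    from r_seq_sums[OF this C] sums show ?thesis by (rule sums_unique2)
  qed
  ultimately show ?thesis
    using sums_summable[OF sums] sums_unique[OF sums] by auto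
qed

end
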